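(* Let $n\ge 2$ be an integer and let $G$ be a finite $n$-BFC-group. Then $$|G:Z_\infty(G)|<n^{64(\log n)^5}.$$
   Context: A group $G$ is called an $n$-BFC-group if each of its conjugacy classes is finite and contains at most $n$ elements. The hypercentre $Z_\infty(G)$ of a finite group $G$ is the last term of the upper central series $1=Z_0(G)\le Z_1(G)=Z(G)\le Z_2(G)\le\dots$, that is, the term at which the series stabilises; here $Z_{i+1}(G)/Z_i(G)=Z(G/Z_i(G))$. The symbol $\log$ denotes the logarithm to base $2$. *)

theory Defs
  imports Complex_Main "HOL-Algebra.Algebra"
begin

definition conjugacy_class :: "('a, 'b) monoid_scheme \<Rightarrow> 'a \<Rightarrow> 'a set" where
  "conjugacy_class G x = {g \<otimes>\<^bsub>G\<^esub> x \<otimes>\<^bsub>G\<^esub> inv\<^bsub>G\<^esub> g | g. g \<in> carrier G}"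

lemma conjugacy_class_eq_orbit:
  assumes "x \<in> carrier G"
  shows "conjugacy_class G x =
    orbit G (\<lambda>g. \<lambda>h \<in> carrier G. g \<otimes>\<^bsub>G\<^esub> h \<otimes>\<^bsub>G\<^esub> inv\<^bsub>G\<^esub> g) x"
  using assms by (simp add: conjugacy_class_def orbit_def)

definition BFC_group :: "nat \<Rightarrow> ('a, 'b) monoid_scheme \<Rightarrow> bool" where
  "BFC_group n G \<longleftrightarrow> group G \<and>
     (\<forall>x \<in> carrier G. finite (conjugacy_class G x) \<and> card (conjugacy_class G x) \<le> n)"

definition centre :: "('a, 'b) monoid_scheme \<Rightarrow> 'a set" where
  "centre G = {z \<in> carrier G. \<forall>g \<in> carrier G. z \<otimes>\<^bsub>G\<^esub> g = g \<otimes>\<^bsub>G\<^esub> z}"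

text \<open>Each term is the full preimage, under the projection modulo the previous term, of the
  centre of the quotient; see \<open>upper_central_quotient\<close> below.\<close>

primrec upper_central :: "('a, 'b) monoid_scheme \<Rightarrow> nat \<Rightarrow> 'a set" where
  "upper_central G 0 = {\<one>\<^bsub>G\<^esub>}"
| "upper_central G (Suc i) =
     {x \<in> carrier G. upper_central G i #>\<^bsub>G\<^esub> x \<in> centre (G Mod upper_central G i)}"

text \<open>For a finite group the series becomes stationary, so the least index below exists
  (\<open>upper_central_stabilises\<close>). For infinite groups the definition is not meaningful in general.\<close>

definition hypercentre :: "('a, 'b) monoid_scheme \<Rightarrow> 'a set" where
  "hypercentre G =
     upper_central G (LEAST i. upper_central G (Suc i) = upper_central G i)"

lemma (in group) subgroup_centre: "subgroup (centre G) G"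
proof (rule subgroupI)
  show "centre G \<subseteq> carrier G" by (auto simp: centre_def)
  have "\<one> \<in> centre G" by (simp add: centre_def)
  then show "centre G \<noteq> {}" by blast
next
  fix a assume "a \<in> centre G"
  then have a: "a \<in> carrier G" "\<And>g. g \<in> carrier G \<Longrightarrow> a \<otimes> g = g \<otimes> a"
    by (auto simp: centre_def)
  have "inv a \<otimes> g = g \<otimes> inv a" if g: "g \<in> carrier G" for g
  proof -
    have "inv a \<otimes> g = inv (inv g \<otimes> a)" using a(1) g by (simp add: inv_mult_group)
    also have "inv g \<otimes> a = a \<otimes> inv g" using a(2) g by simp
    also have "inv (a \<otimes> inv g) = g \<otimes> inv a" using a(1) g by (simp add: inv_mult_group)
    finally show ?thesis .
  qed
  then show "inv a \<in> centre G" using a(1) by (simp add: centre_def)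
next
  fix a b assume "a \<in> centre G" "b \<in> centre G"
  then have ab: "a \<in> carrier G" "b \<in> carrier G"
    and comm: "\<And>g. g \<in> carrier G \<Longrightarrow> a \<otimes> g = g \<otimes> a" "\<And>g. g \<in> carrier G \<Longrightarrow> b \<otimes> g = g \<otimes> b"
    by (auto simp: centre_def)
  have "a \<otimes> b \<otimes> g = g \<otimes> (a \<otimes> b)" if g: "g \<in> carrier G" for g
  proof -
    have "a \<otimes> b \<otimes> g = a \<otimes> (g \<otimes> b)" using ab g comm(2)[OF g] by (simp add: m_assoc)
    also have "\<dots> = a \<otimes> g \<otimes> b" using ab g by (simp add: m_assoc)
    also have "\<dots> = g \<otimes> (a \<otimes> b)" using ab g comm(1)[OF g] by (simp add: m_assoc)
    finally show ?thesis .
  qed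
  then show "a \<otimes> b \<in> centre G" using ab by (simp add: centre_def)
qed

lemma (in group) upper_central_subset: "upper_central G i \<subseteq> carrier G"
  by (cases i) auto

lemma (in group) upper_central_normal: "upper_central G i \<lhd> G"
proof (induction i)
  case 0
  show ?case by (simp add: one_is_normal)
next
  case (Suc i)
  let ?N = "upper_central G i"
  interpret N: normal ?N G by (fact Suc)
  interpret Q: group "G Mod ?N" by (rule N.factorgroup_is_group)
  interpret h: group_hom G "G Mod ?N" "\<lambda>x. ?N #> x"
    by unfold_locales (rule N.r_coset_hom_Mod)
  interpret Z: subgroup "centre (G Mod ?N)" "G Mod ?N" by (rule Q.subgroup_centre)
  have mem: "x \<in> upper_central G (Suc i) \<longleftrightarrow> x \<in> carrier G \<and> ?N #> x \<in> centre (G Mod ?N)" for x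
    by simp
  have sub: "subgroup (upper_central G (Suc i)) G"
  proof (rule subgroupI)
    show "upper_central G (Suc i) \<subseteq> carrier G" by (rule upper_central_subset)
    have "\<one> \<in> upper_central G (Suc i)"
      unfolding mem h.hom_one using Z.one_closed by blast
    then show "upper_central G (Suc i) \<noteq> {}" by blast
  next
    fix a assume a: "a \<in> upper_central G (Suc i)"
    then show "inv a \<in> upper_central G (Suc i)"
      unfolding mem using h.hom_inv[of a] Z.m_inv_closed[of "?N #> a"] by auto
  next
    fix a b assume "a \<in> upper_central G (Suc i)" "b \<in> upper_central G (Suc i)"
    then show "a \<otimes> b \<in> upper_central G (Suc i)"
      unfolding mem using h.hom_mult[of a b] Z.m_closed[of "?N #> a" "?N #> b"] by auto
  qed
  show ?case
  proof (rule normal_invI[OF sub])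
    fix x h assume x: "x \<in> carrier G" and h: "h \<in> upper_central G (Suc i)"
    let ?X = "?N #> x" and ?H = "?N #> h"
    have hc: "h \<in> carrier G" and hz: "?H \<in> centre (G Mod ?N)" using h mem by auto
    have X: "?X \<in> carrier (G Mod ?N)" using x by (rule h.hom_closed)
    have H: "?H \<in> carrier (G Mod ?N)" using hc by (rule h.hom_closed)
    have "?N #> (x \<otimes> h \<otimes> inv x)
        = ?X \<otimes>\<^bsub>G Mod ?N\<^esub> ?H \<otimes>\<^bsub>G Mod ?N\<^esub> inv\<^bsub>G Mod ?N\<^esub> ?X"
      by (simp only: h.hom_mult h.hom_inv x hc m_closed inv_closed)
    also have "?X \<otimes>\<^bsub>G Mod ?N\<^esub> ?H = ?H \<otimes>\<^bsub>G Mod ?N\<^esub> ?X"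
      using hz X unfolding centre_def by blast
    also have "?H \<otimes>\<^bsub>G Mod ?N\<^esub> ?X \<otimes>\<^bsub>G Mod ?N\<^esub> inv\<^bsub>G Mod ?N\<^esub> ?X = ?H"
      using X H by (simp only: Q.m_assoc Q.inv_closed Q.r_inv Q.r_one)
    finally show "x \<otimes> h \<otimes> inv x \<in> upper_central G (Suc i)"
      unfolding mem using x hc hz by (metis m_closed inv_closed)
  qed
qed

lemma (in group) upper_central_quotient:
  "(\<lambda>x. upper_central G i #> x) ` upper_central G (Suc i) = centre (G Mod upper_central G i)"
  by (auto simp: centre_def FactGroup_def RCOSETS_def image_iff)

lemma (in group) upper_central_mono: "upper_central G i \<subseteq> upper_central G (Suc i)"
proof
  fix x assume x: "x \<in> upper_central G i"
  let ?N = "upper_central G i"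
  interpret N: normal ?N G by (rule upper_central_normal)
  interpret Q: group "G Mod ?N" by (rule N.factorgroup_is_group)
  interpret Z: subgroup "centre (G Mod ?N)" "G Mod ?N" by (rule Q.subgroup_centre)
  have "?N #> x = \<one>\<^bsub>G Mod ?N\<^esub>"
    using N.rcos_const[OF is_group x] by (simp add: FactGroup_def)
  then show "x \<in> upper_central G (Suc i)"
    using x upper_central_subset[of i] Z.one_closed by auto
qed

lemma (in group) upper_central_stabilises:
  assumes "finite (carrier G)"
  shows "\<exists>i. upper_central G (Suc i) = upper_central G i"
proof (rule ccontr)
  assume "\<not> ?thesis"
  then have "upper_central G i \<subset> upper_central G (Suc i)" for i
    using upper_central_mono by blast
  then have less: "card (upper_central G i) < card (upper_central G (Suc i))" for i
    by (rule psubset_card_mono[OF finite_subset[OF upper_central_subset assms]])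
  have "i \<le> card (upper_central G i)" for i
  proof (induction i)
    case (Suc i)
    then show ?case using less[of i] by linarith
  qed simp
  moreover have "card (upper_central G i) \<le> card (carrier G)" for i
    using card_mono[OF assms upper_central_subset] .
  ultimately have "Suc (card (carrier G)) \<le> card (carrier G)"
    by (rule le_trans)
  then show False by simp
qed

end

theory Submission
  imports Defs
begin

text \<open>
  Write \<open>k = log 2 n\<close>. The bound already holds for the second centre \<open>Z\<^sub>2(G)\<close>, which lies in the
  hypercentre, and with the exponent \<open>8 k\<^sup>2\<close> of \<open>n\<close>; the argument is elementary.

  Let \<open>a\<close> have a conjugacy class of maximal size. Since \<open>C(a)\<close> has index at most \<open>n\<close>, some set \<open>S\<close>
  of at most \<open>2k + 1\<close> elements generates a subgroup \<open>\<langle>S\<rangle>\<close> transitive on the class of \<open>a\<close>; this is an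
  averaging argument (\<open>few_elements_transitive_on_cosets\<close>). If \<open>u\<close> centralises \<open>S\<close>, then conjugating
  \<open>ua\<close> by \<open>\<langle>S\<rangle>\<close> alone yields \<open>u\<close> times the class of \<open>a\<close>, and by maximality this is the whole
  class of \<open>ua\<close>. Comparing with an arbitrary conjugate of \<open>ua\<close> shows that \<open>[u,g]\<close> lies in
  \<open>\<langle>S,a\<rangle>\<close> for every \<open>g\<close> in \<open>G\<close> (\<open>commutator_in_generate\<close>).

  Put \<open>W = C(S \<union> {a})\<close>, a subgroup of index at most \<open>n\<close> to the power \<open>2k + 2\<close>. Then \<open>[W,G]\<close> lies in
  \<open>\<langle>S,a\<rangle>\<close> and so is centralised by \<open>W\<close>; the three subgroups lemma gives \<open>[W,W] \<le> Z(G)\<close>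
  (\<open>commutator_in_centre\<close>). Choose \<open>T\<close> with \<open>G = \<langle>W,T\<rangle>\<close> and \<open>|T| \<le> log 2 |G:W| \<le> (2k + 2)k\<close>. An
  element of \<open>W\<close> centralising \<open>T\<close> commutes with \<open>W\<close> and with \<open>T\<close> modulo \<open>Z(G)\<close>, hence with all of
  \<open>G\<close>, so it lies in \<open>Z\<^sub>2(G)\<close>. Such elements form a subgroup of index at most \<open>n\<close> to the power
  \<open>|T|\<close> in \<open>W\<close>. Altogether the exponent is at most \<open>(2k + 2)(k + 1) \<le> 8 k\<^sup>2 < 64 k\<^sup>5\<close>.
\<close>

section \<open>Centralisers and conjugacy classes\<close>

definition centralizer :: "('a, 'b) monoid_scheme \<Rightarrow> 'a set \<Rightarrow> 'a set" where
  "centralizer G S = {x \<in> carrier G. \<forall>s \<in> S. x \<otimes>\<^bsub>G\<^esub> s = s \<otimes>\<^bsub>G\<^esub> x}"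

context group
begin

lemma mult_inv_cancel_left:
  assumes "x \<in> carrier G" "y \<in> carrier G"
  shows "x \<otimes> (inv x \<otimes> y) = y" and "inv x \<otimes> (x \<otimes> y) = y"
  using assms by (simp_all flip: m_assoc)

lemma commute_inv:
  assumes "x \<in> carrier G" "y \<in> carrier G" "x \<otimes> y = y \<otimes> x"
  shows "x \<otimes> inv y = inv y \<otimes> x"
  using assms by (metis inv_closed inv_solve_left inv_solve_right m_assoc m_closed)

lemma subgroup_centralizer:
  assumes "S \<subseteq> carrier G"
  shows "subgroup (centralizer G S) G"
proof (rule subgroupI)
  show "centralizer G S \<subseteq> carrier G" by (auto simp: centralizer_def)
  have "\<one> \<in> centralizer G S" using assms by (auto simp: centralizer_def)
  then show "centralizer G S \<noteq> {}" by blast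
next
  fix a assume "a \<in> centralizer G S"
  then show "inv a \<in> centralizer G S"
    using assms commute_inv[of _ a] by (auto simp: centralizer_def subset_iff)
next
  fix a b assume "a \<in> centralizer G S" "b \<in> centralizer G S"
  then show "a \<otimes> b \<in> centralizer G S"
    using assms unfolding centralizer_def by (auto simp: subset_iff) (metis m_assoc)
qed

lemma centralizer_generate:
  assumes "S \<subseteq> carrier G"
  shows "centralizer G (generate G S) = centralizer G S"
proof
  show "centralizer G (generate G S) \<subseteq> centralizer G S"
    by (auto simp: centralizer_def intro: generate.incl)
  show "centralizer G S \<subseteq> centralizer G (generate G S)"
  proof
    fix x assume x: "x \<in> centralizer G S"
    then have xc: "x \<in> carrier G" by (auto simp: centralizer_def)
    have "subgroup (centralizer G {x}) G" using subgroup_centralizer xc by simp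
    moreover have "S \<subseteq> centralizer G {x}"
      using x assms by (auto simp: centralizer_def)
    ultimately have "generate G S \<subseteq> centralizer G {x}"
      using generate_subgroup_incl by blast
    then show "x \<in> centralizer G (generate G S)"
      using xc by (auto simp: centralizer_def)
  qed
qed

text \<open>The fibres of \<open>k \<mapsto> k x k\<inverse>\<close> on \<open>K\<close> are cosets of \<open>K \<inter> C(x)\<close>.\<close>

lemma card_le_conjugacy_class_times_centralizer:
  assumes fin: "finite (carrier G)" and K: "subgroup K G" and x: "x \<in> carrier G"
  shows "card K \<le> card (conjugacy_class G x) * card (K \<inter> centralizer G {x})"
proof -
  let ?f = "\<lambda>k. k \<otimes> x \<otimes> inv k"
  have Kc: "K \<subseteq> carrier G" using K by (rule subgroup.subset)
  have finK: "finite K" using Kc fin finite_subset by blast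
  have fincl: "finite (conjugacy_class G x)"
    using fin by (auto simp: conjugacy_class_def Setcompr_eq_image)
  have fibre: "card {k \<in> K. ?f k = y} \<le> card (K \<inter> centralizer G {x})" for y
  proof (cases "\<exists>k0 \<in> K. ?f k0 = y")
    case True
    then obtain k0 where k0: "k0 \<in> K" "?f k0 = y" by blast
    have k0c: "k0 \<in> carrier G" using k0 Kc by blast
    show ?thesis
    proof (rule card_inj_on_le[where f = "\<lambda>k. inv k0 \<otimes> k"])
      show "inj_on (\<lambda>k. inv k0 \<otimes> k) {k \<in> K. ?f k = y}"
        using k0c Kc by (auto simp: inj_on_def subset_iff)
      show "(\<lambda>k. inv k0 \<otimes> k) ` {k \<in> K. ?f k = y} \<subseteq> K \<inter> centralizer G {x}"
      proof (rule image_subsetI)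
        fix k assume "k \<in> {k \<in> K. ?f k = y}"
        then have k: "k \<in> K" and "?f k = y" by auto
        then have "?f k = ?f k0" using k0 by simp
        moreover have kc: "k \<in> carrier G" using k Kc by blast
        ultimately have "k \<otimes> x = k0 \<otimes> x \<otimes> inv k0 \<otimes> k"
          using k0c x by (metis inv_solve_right m_closed inv_closed)
        then have "inv k0 \<otimes> k \<otimes> x = x \<otimes> (inv k0 \<otimes> k)"
          using k0c kc x by (simp add: m_assoc inv_solve_left')
        moreover have "inv k0 \<otimes> k \<in> K"
          using k0 k K by (simp add: subgroup.m_closed subgroup.m_inv_closed)
        ultimately show "inv k0 \<otimes> k \<in> K \<inter> centralizer G {x}"
          using Kc by (auto simp: centralizer_def)
      qed
      show "finite (K \<inter> centralizer G {x})" using finK by simp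
    qed
  next
    case False
    then have "{k \<in> K. ?f k = y} = {}" by blast
    then show ?thesis by (simp only: card.empty)
  qed
  have "K = (\<Union>y \<in> conjugacy_class G x. {k \<in> K. ?f k = y})"
    using Kc by (auto simp: conjugacy_class_def)
  then have "card K = card (\<Union>y \<in> conjugacy_class G x. {k \<in> K. ?f k = y})" by simp
  also have "\<dots> \<le> (\<Sum>y \<in> conjugacy_class G x. card {k \<in> K. ?f k = y})"
    by (rule card_UN_le[OF fincl])
  also have "\<dots> \<le> (\<Sum>y \<in> conjugacy_class G x. card (K \<inter> centralizer G {x}))"
    by (rule sum_mono) (rule fibre)
  finally show ?thesis by simp
qed

text \<open>Relative to an arbitrary subgroup \<open>K\<close>, because the main argument intersects centralisers in two
  stages: first inside \<open>G\<close>, then inside \<open>W\<close>.\<close>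

lemma card_le_power_times_centralizer:
  assumes fin: "finite (carrier G)"
    and bfc: "\<And>x. x \<in> carrier G \<Longrightarrow> card (conjugacy_class G x) \<le> n"
    and K: "subgroup K G" and S: "finite S" "S \<subseteq> carrier G"
  shows "card K \<le> n ^ card S * card (K \<inter> centralizer G S)"
  using S
proof (induction S rule: finite_induct)
  case empty
  have "K \<inter> centralizer G {} = K"
    using subgroup.subset[OF K] by (auto simp: centralizer_def)
  then show ?case by simp
next
  case (insert s S)
  let ?L = "K \<inter> centralizer G S"
  have L: "subgroup ?L G"
    using insert.prems by (intro subgroups_Inter_pair K subgroup_centralizer) auto
  have "card ?L \<le> card (conjugacy_class G s) * card (?L \<inter> centralizer G {s})"
    by (rule card_le_conjugacy_class_times_centralizer[OF fin L]) (use insert.prems in auto)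
  also have "\<dots> \<le> n * card (?L \<inter> centralizer G {s})"
    using bfc[of s] insert.prems by (intro mult_right_mono) auto
  also have "?L \<inter> centralizer G {s} = K \<inter> centralizer G (insert s S)"
    by (auto simp: centralizer_def)
  finally have "n ^ card S * card ?L
      \<le> n ^ card S * (n * card (K \<inter> centralizer G (insert s S)))"
    by (rule mult_left_mono) simp
  with insert have "card K \<le> n ^ card S * (n * card (K \<inter> centralizer G (insert s S)))"
    by (meson insert_subset le_trans)
  then show ?case using insert.hyps by (simp add: mult_ac)
qed

text \<open>Each element adjoined to a proper subgroup from outside at least doubles its order.\<close>

lemma generating_complement_of_subgroup:
  assumes fin: "finite (carrier G)" and "subgroup H G"
  shows "\<exists>S \<subseteq> carrier G. generate G (H \<union> S) = carrier G \<and> 2 ^ card S * card H \<le> card (carrier G)"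
  using assms(2)
proof (induction "card (carrier G) - card H" arbitrary: H rule: less_induct)
  case less
  note H = less.prems
  have Hc: "H \<subseteq> carrier G" using H by (rule subgroup.subset)
  have finH: "finite H" using Hc fin finite_subset by blast
  show ?case
  proof (cases "H = carrier G")
    case True
    have "generate G H = carrier G" using True generate_incl[of H] generate.incl[of _ H G] by auto
    then show ?thesis using True by (intro exI[of _ "{}"]) auto
  next
    case False
    then obtain g where g: "g \<in> carrier G" "g \<notin> H" using Hc by blast
    define K where "K = generate G (insert g H)"
    have K: "subgroup K G" unfolding K_def by (rule generate_is_subgroup) (use g Hc in auto)
    have Kc: "K \<subseteq> carrier G" using K by (rule subgroup.subset)
    have gK: "g \<in> K" and HK: "H \<subseteq> K" unfolding K_def by (auto intro: generate.incl)
    have inj: "inj_on (\<lambda>h. g \<otimes> h) H" using g Hc by (auto simp: inj_on_def subset_iff)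
    have disj: "H \<inter> (\<lambda>h. g \<otimes> h) ` H = {}"
    proof (rule ccontr)
      assume "\<not> ?thesis"
      then obtain h where h: "h \<in> H" "g \<otimes> h \<in> H" by blast
      then have "g \<otimes> h \<otimes> inv h \<in> H"
        using H by (simp add: subgroup.m_closed subgroup.m_inv_closed)
      moreover have "g \<otimes> h \<otimes> inv h = g" using g h Hc by (simp add: m_assoc subset_iff)
      ultimately show False using g by simp
    qed
    have "2 * card H = card (H \<union> (\<lambda>h. g \<otimes> h) ` H)"
      using finH disj inj by (simp add: card_Un_disjoint card_image)
    also have "\<dots> \<le> card K"
      using fin Kc finite_subset HK gK K
      by (intro card_mono) (auto intro: subgroup.m_closed)
    finally have double: "2 * card H \<le> card K" .
    have "card H > 0" using finH H subgroup.one_closed card_gt_0_iff by blast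
    moreover have "card K \<le> card (carrier G)" by (rule card_mono[OF fin Kc])
    ultimately have "card (carrier G) - card K < card (carrier G) - card H"
      using double by linarith
    from less.hyps[OF this K] obtain S where S: "S \<subseteq> carrier G"
      "generate G (K \<union> S) = carrier G" "2 ^ card S * card K \<le> card (carrier G)"
      by blast
    have sub: "subgroup (generate G (H \<union> insert g S)) G"
      by (rule generate_is_subgroup) (use g Hc S in auto)
    have "K \<subseteq> generate G (H \<union> insert g S)"
      unfolding K_def by (rule mono_generate) auto
    moreover have "S \<subseteq> generate G (H \<union> insert g S)" by (auto intro: generate.incl)
    ultimately have "generate G (K \<union> S) \<subseteq> generate G (H \<union> insert g S)"
      using sub generate_subgroup_incl by simp
    then have gen: "generate G (H \<union> insert g S) = carrier G"
      using S subgroup.subset[OF sub] by auto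
    have finS: "finite S" using S fin finite_subset by blast
    have "2 ^ card (insert g S) * card H \<le> 2 ^ Suc (card S) * card H"
      using finS by (intro mult_right_mono power_increasing) (auto simp: card_insert_if)
    also have "\<dots> \<le> 2 ^ card S * card K" using double by simp
    also have "\<dots> \<le> card (carrier G)" by (fact S)
    finally show ?thesis using gen g S by (intro exI[of _ "insert g S"]) auto
  qed
qed

section \<open>Few elements suffice for transitivity\<close>

text \<open>The overlaps of \<open>Y\<close> with its translates \<open>gY\<close> sum to \<open>|Y|\<^sup>2\<close> over \<open>g\<close> in \<open>G\<close>, as each pair in
  \<open>Y \<times> Y\<close> is matched by exactly one \<open>g\<close>; some overlap is at most the average.\<close>

lemma translate_with_small_overlap:
  assumes fin: "finite (carrier G)" and Y: "Y \<subseteq> carrier G"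
  shows "\<exists>g \<in> carrier G. card {y \<in> Y. inv g \<otimes> y \<in> Y} * card (carrier G) \<le> (card Y)\<^sup>2"
proof (rule ccontr)
  assume "\<not> ?thesis"
  then have less: "(card Y)\<^sup>2 < card {y \<in> Y. inv g \<otimes> y \<in> Y} * card (carrier G)"
    if "g \<in> carrier G" for g using that by (meson not_le)
  have finY: "finite Y" using Y fin finite_subset by blast
  have inner: "card {g \<in> carrier G. inv g \<otimes> y \<in> Y} = card Y" if y: "y \<in> Y" for y
  proof -
    have "bij_betw (\<lambda>g. inv g \<otimes> y) {g \<in> carrier G. inv g \<otimes> y \<in> Y} Y"
      by (rule bij_betw_byWitness[where f' = "\<lambda>z. y \<otimes> inv z"])
        (use y Y in \<open>auto simp: subset_iff inv_mult_group m_assoc mult_inv_cancel_left\<close>)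
    then show ?thesis by (rule bij_betw_same_card)
  qed
  have "(\<Sum>g \<in> carrier G. card {y \<in> Y. inv g \<otimes> y \<in> Y})
      = (\<Sum>y \<in> Y. card {g \<in> carrier G. inv g \<otimes> y \<in> Y})"
    using sum_multicount_gen[OF fin finY, of "\<lambda>g y. inv g \<otimes> y \<in> Y"
        "\<lambda>y. card {g \<in> carrier G. inv g \<otimes> y \<in> Y}"] by simp
  also have "\<dots> = (card Y)\<^sup>2" using inner by (simp add: power2_eq_square)
  finally have total: "(\<Sum>g \<in> carrier G. card {y \<in> Y. inv g \<otimes> y \<in> Y}) = (card Y)\<^sup>2" .
  have "(\<Sum>g \<in> carrier G. (card Y)\<^sup>2)
      < (\<Sum>g \<in> carrier G. card {y \<in> Y. inv g \<otimes> y \<in> Y} * card (carrier G))"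
    using fin one_closed less by (intro sum_strict_mono) auto
  then have "card (carrier G) * (card Y)\<^sup>2 < card (carrier G) * (card Y)\<^sup>2"
    by (simp add: total flip: sum_distrib_right)
  then show False by simp
qed

text \<open>For \<open>C\<close> a subgroup, \<open>\<langle>S\<rangle>\<close> is transitive on the left cosets of \<open>C\<close> exactly when this set is
  empty.\<close>

definition off_product :: "'a set \<Rightarrow> 'a set \<Rightarrow> 'a set" where
  "off_product C S = carrier G - {h \<otimes> c | h c. h \<in> generate G S \<and> c \<in> C}"

text \<open>Adjoining a suitable \<open>g\<close> to \<open>S\<close> brings the proportion of elements outside \<open>\<langle>S\<rangle>C\<close> down to at
  most its square: what is still left outside lies in the overlap of the old complement with its translate by \<open>g\<close>. Hence
  the doubly exponential decay.\<close>

lemma few_off_product: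
  assumes fin: "finite (carrier G)" and C: "C \<subseteq> carrier G"
  shows "\<exists>S \<subseteq> carrier G. card S \<le> t \<and>
    real (card (off_product C S)) / card (carrier G)
      \<le> (1 - real (card C) / card (carrier G)) ^ (2 ^ t)"
proof (induction t)
  case 0
  have finC: "finite C" using C fin finite_subset by blast
  have "off_product C {} = carrier G - C"
    using C by (auto simp: off_product_def generate_empty)
  moreover have "card (carrier G) > 0" using fin card_gt_0_iff one_closed by blast
  ultimately have "real (card (off_product C {})) / card (carrier G)
      = 1 - real (card C) / card (carrier G)"
    using finC C fin by (simp add: card_Diff_subset card_mono of_nat_diff
        diff_divide_distrib del: card_gt_0_iff) auto
  then show ?case by (intro exI[of _ "{}"]) auto
next
  case (Suc t)
  then obtain S where S: "S \<subseteq> carrier G" "card S \<le> t"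
    and le: "real (card (off_product C S)) / card (carrier G)
      \<le> (1 - real (card C) / card (carrier G)) ^ (2 ^ t)" by blast
  let ?Y = "off_product C S" and ?m = "card (carrier G)"
  have m: "?m > 0" using fin card_gt_0_iff one_closed by blast
  have Y: "?Y \<subseteq> carrier G" by (auto simp: off_product_def)
  obtain g where g: "g \<in> carrier G"
    and small: "card {y \<in> ?Y. inv g \<otimes> y \<in> ?Y} * ?m \<le> (card ?Y)\<^sup>2"
    using translate_with_small_overlap[OF fin Y] by blast
  have gen: "generate G S \<subseteq> generate G (insert g S)" by (rule mono_generate) auto
  have genc: "generate G S \<subseteq> carrier G" by (rule generate_incl[OF S(1)])
  have "off_product C (insert g S) \<subseteq> {y \<in> ?Y. inv g \<otimes> y \<in> ?Y}"
  proof
    fix y assume y: "y \<in> off_product C (insert g S)"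
    then have yc: "y \<in> carrier G" by (simp add: off_product_def)
    have "y \<in> ?Y" using y gen by (auto simp: off_product_def)
    moreover have "inv g \<otimes> y \<noteq> h \<otimes> c" if h: "h \<in> generate G S" and c: "c \<in> C" for h c
    proof
      assume "inv g \<otimes> y = h \<otimes> c"
      then have "y = g \<otimes> (h \<otimes> c)"
        using g yc h c C genc by (metis inv_solve_left m_closed subset_iff)
      then have "y = g \<otimes> h \<otimes> c" using g h c C genc by (simp add: m_assoc subset_iff)
      moreover have "g \<otimes> h \<in> generate G (insert g S)"
        using h gen by (intro generate.eng) (auto intro: generate.incl)
      ultimately show False using y c by (auto simp: off_product_def)
    qed
    ultimately show "y \<in> {y \<in> ?Y. inv g \<otimes> y \<in> ?Y}"
      using g yc by (auto simp: off_product_def)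
  qed
  then have "card (off_product C (insert g S)) \<le> card {y \<in> ?Y. inv g \<otimes> y \<in> ?Y}"
    using fin Y finite_subset by (intro card_mono) (auto simp: off_product_def)
  then have "card (off_product C (insert g S)) * ?m \<le> (card ?Y)\<^sup>2"
    using small by (meson le_trans mult_le_mono1)
  then have "real (card (off_product C (insert g S)) * ?m) \<le> real ((card ?Y)\<^sup>2)"
    by (rule of_nat_mono)
  then have "real (card (off_product C (insert g S))) / ?m \<le> (real (card ?Y) / ?m)\<^sup>2"
    using m by (simp add: field_simps power2_eq_square)
  also have "\<dots> \<le> ((1 - real (card C) / ?m) ^ (2 ^ t))\<^sup>2"
    by (rule power_mono[OF le]) simp
  also have "\<dots> = (1 - real (card C) / ?m) ^ (2 ^ Suc t)"
    by (simp flip: power_mult add: mult.commute)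
  finally have "real (card (off_product C (insert g S))) / ?m
      \<le> (1 - real (card C) / ?m) ^ (2 ^ Suc t)" .
  moreover have "card (insert g S) \<le> Suc t"
    using S finite_subset[OF _ fin] by (simp add: card_insert_if)
  ultimately show ?case using g S by (intro exI[of _ "insert g S"]) auto
qed

text \<open>The proportion outside \<open>\<langle>S\<rangle>C\<close> is at most \<open>(1 - 1/N)\<close> to the power \<open>N\<^sup>2\<close>, which is below \<open>1/N\<close>.
  As the complement of \<open>\<langle>S\<rangle>C\<close> is a union of left cosets of \<open>C\<close>, each of proportion at least
  \<open>1/N\<close>, it is empty.\<close>

lemma few_elements_transitive_on_cosets:
  assumes fin: "finite (carrier G)" and C: "subgroup C G"
    and index: "card (carrier G) \<le> N * card C" and t: "N\<^sup>2 \<le> 2 ^ t"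
  shows "\<exists>S \<subseteq> carrier G. card S \<le> t \<and>
    (\<forall>g \<in> carrier G. \<exists>h \<in> generate G S. \<exists>c \<in> C. g = h \<otimes> c)"
proof -
  let ?m = "card (carrier G)"
  have Cc: "C \<subseteq> carrier G" using C by (rule subgroup.subset)
  have m: "?m > 0" using fin card_gt_0_iff one_closed by blast
  then have N: "N > 0" using index by (cases N) auto
  have density: "1 / N \<le> real (card C) / ?m"
  proof -
    have "real ?m \<le> real N * real (card C)"
      using index by (metis of_nat_le_iff of_nat_mult)
    then show ?thesis using m N by (simp add: field_simps)
  qed
  have dens1: "real (card C) / ?m \<le> 1" using m card_mono[OF fin Cc] by simp
  obtain S where S: "S \<subseteq> carrier G" "card S \<le> t"
    and le: "real (card (off_product C S)) / ?m \<le> (1 - real (card C) / ?m) ^ (2 ^ t)"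
    using few_off_product[OF fin Cc] by blast
  have "1 - real (card C) / ?m \<le> exp (- (1 / N))"
    using density exp_ge_add_one_self[of "- (1 / real N)"] by linarith
  then have "(1 - real (card C) / ?m) ^ (2 ^ t) \<le> exp (- (1 / N)) ^ (2 ^ t)"
    using dens1 by (intro power_mono) auto
  also have "\<dots> = exp (- (2 ^ t / N))"
    by (simp flip: exp_of_nat_mult)
  also have "\<dots> \<le> exp (- real N)"
  proof -
    have "real (N\<^sup>2) \<le> real (2 ^ t)" using t by (rule of_nat_mono)
    then have "real N \<le> 2 ^ t / N" using N by (simp add: field_simps power2_eq_square)
    then show ?thesis by simp
  qed
  also have "\<dots> < 1 / N"
  proof -
    have "real N < exp (real N)" using exp_ge_add_one_self[of "real N"] by linarith
    then show ?thesis using N by (simp add: exp_minus field_simps)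
  qed
  finally have "real (card (off_product C S)) / ?m < real (card C) / ?m"
    using le density by linarith
  then have small: "card (off_product C S) < card C" using m by (simp add: divide_less_cancel)
  have "off_product C S = {}"
  proof (rule ccontr)
    assume "off_product C S \<noteq> {}"
    then obtain y where y: "y \<in> off_product C S" by blast
    then have yc: "y \<in> carrier G" by (simp add: off_product_def)
    have "(\<lambda>c. y \<otimes> c) ` C \<subseteq> off_product C S"
    proof clarify
      fix c assume c: "c \<in> C"
      have "y \<otimes> c \<noteq> h \<otimes> c'" if h: "h \<in> generate G S" and c': "c' \<in> C" for h c'
      proof
        assume "y \<otimes> c = h \<otimes> c'"
        then have "y = h \<otimes> c' \<otimes> inv c"
          using yc h c c' Cc generate_incl[OF S(1)] by (metis inv_solve_right m_closed subset_iff)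
        then have "y = h \<otimes> (c' \<otimes> inv c)"
          using h c c' Cc generate_incl[OF S(1)] by (simp add: m_assoc subset_iff)
        moreover have "c' \<otimes> inv c \<in> C"
          using C c c' by (simp add: subgroup.m_closed subgroup.m_inv_closed)
        ultimately show False using y h by (auto simp: off_product_def)
      qed
      then show "y \<otimes> c \<in> off_product C S" using yc c Cc by (auto simp: off_product_def)
    qed
    moreover have "inj_on (\<lambda>c. y \<otimes> c) C" using yc Cc by (auto simp: inj_on_def subset_iff)
    moreover have "finite (off_product C S)" using fin by (simp add: off_product_def)
    ultimately have "card C \<le> card (off_product C S)" by (metis card_inj_on_le)
    then show False using small by simp
  qed
  then have "carrier G \<subseteq> {h \<otimes> c | h c. h \<in> generate G S \<and> c \<in> C}" by (simp add: off_product_def)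
  then have "\<forall>g \<in> carrier G. \<exists>h \<in> generate G S. \<exists>c \<in> C. g = h \<otimes> c" by fast
  with S show ?thesis by blast
qed


section \<open>Commutators with a large centraliser\<close>

text \<open>By maximality of the class of \<open>a\<close>, the conjugates of \<open>ua\<close> under \<open>\<langle>S\<rangle>\<close>, which are the products
  \<open>u y\<close> with \<open>y\<close> conjugate to \<open>a\<close>, exhaust the class of \<open>ua\<close>. So
  \<open>(g u g\<inverse>)(g a g\<inverse>) = u y\<close> for some such \<open>y\<close>, which expresses the commutator by two conjugates of
  \<open>a\<close>, and all of these lie in \<open>\<langle>S,a\<rangle>\<close>.\<close>

lemma commutator_in_generate:
  assumes fin: "finite (carrier G)" and a: "a \<in> carrier G"
    and max: "\<And>x. x \<in> carrier G \<Longrightarrow> card (conjugacy_class G x) \<le> card (conjugacy_class G a)"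
    and S: "S \<subseteq> carrier G"
    and trans: "\<And>g. g \<in> carrier G \<Longrightarrow>
      \<exists>h \<in> generate G S. \<exists>c \<in> centralizer G {a}. g = h \<otimes> c"
    and u: "u \<in> centralizer G S" and g: "g \<in> carrier G"
  shows "inv u \<otimes> (g \<otimes> u \<otimes> inv g) \<in> generate G (insert a S)"
proof -
  let ?H = "generate G (insert a S)"
  have H: "subgroup ?H G" by (rule generate_is_subgroup) (use a S in auto)
  have aH: "a \<in> ?H" by (auto intro: generate.incl)
  have SH: "generate G S \<subseteq> ?H" by (rule mono_generate) auto
  have gc: "generate G S \<subseteq> carrier G" by (rule generate_incl[OF S])
  have uc: "u \<in> carrier G" using u by (simp add: centralizer_def)
  have comm: "u \<otimes> h = h \<otimes> u" if "h \<in> generate G S" for h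
    using u that centralizer_generate[OF S] by (auto simp: centralizer_def)
  have class_a: "\<exists>h \<in> generate G S. y = h \<otimes> a \<otimes> inv h" if y: "y \<in> conjugacy_class G a" for y
  proof -
    obtain k where k: "k \<in> carrier G" "y = k \<otimes> a \<otimes> inv k"
      using y by (auto simp: conjugacy_class_def)
    obtain h c where h: "h \<in> generate G S" and c: "c \<in> centralizer G {a}" and kh: "k = h \<otimes> c"
      using trans[OF k(1)] by blast
    have cc: "c \<in> carrier G" "c \<otimes> a = a \<otimes> c" using c by (auto simp: centralizer_def)
    have hc: "h \<in> carrier G" using h gc by blast
    have "y = h \<otimes> (c \<otimes> a) \<otimes> inv c \<otimes> inv h"
      using k(2) kh cc(1) hc a by (simp add: m_assoc inv_mult_group)
    also have "\<dots> = h \<otimes> a \<otimes> inv h" using cc hc a by (simp add: m_assoc mult_inv_cancel_left)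
    finally show ?thesis using h by blast
  qed
  have finclass: "finite (conjugacy_class G x)" for x
    using fin by (auto simp: conjugacy_class_def Setcompr_eq_image)
  have classc: "conjugacy_class G a \<subseteq> carrier G" using a by (auto simp: conjugacy_class_def)
  have "(\<lambda>y. u \<otimes> y) ` conjugacy_class G a = conjugacy_class G (u \<otimes> a)"
  proof (rule card_seteq[OF finclass])
    show "(\<lambda>y. u \<otimes> y) ` conjugacy_class G a \<subseteq> conjugacy_class G (u \<otimes> a)"
    proof clarify
      fix y assume "y \<in> conjugacy_class G a"
      then obtain h where h: "h \<in> generate G S" "y = h \<otimes> a \<otimes> inv h" using class_a by blast
      have hc: "h \<in> carrier G" using h gc by blast
      have "u \<otimes> y = u \<otimes> h \<otimes> a \<otimes> inv h" using h uc hc a by (simp add: m_assoc)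
      also have "\<dots> = h \<otimes> (u \<otimes> a) \<otimes> inv h" using comm[OF h(1)] uc hc a by (simp add: m_assoc)
      finally show "u \<otimes> y \<in> conjugacy_class G (u \<otimes> a)"
        using hc by (auto simp: conjugacy_class_def)
    qed
    have "inj_on (\<lambda>y. u \<otimes> y) (conjugacy_class G a)"
      using uc classc by (auto simp: inj_on_def subset_iff)
    then show "card (conjugacy_class G (u \<otimes> a)) \<le> card ((\<lambda>y. u \<otimes> y) ` conjugacy_class G a)"
      using max[of "u \<otimes> a"] uc a by (simp add: card_image)
  qed
  moreover have "g \<otimes> (u \<otimes> a) \<otimes> inv g \<in> conjugacy_class G (u \<otimes> a)"
    using g by (auto simp: conjugacy_class_def)
  ultimately obtain y where y: "y \<in> conjugacy_class G a" "g \<otimes> (u \<otimes> a) \<otimes> inv g = u \<otimes> y"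
    by blast
  have inH: "x \<in> ?H" if x: "x \<in> conjugacy_class G a" for x
  proof -
    obtain h where "h \<in> generate G S" "x = h \<otimes> a \<otimes> inv h" using class_a[OF x] by blast
    then show ?thesis
      using SH aH H by (simp add: subset_iff subgroup.m_closed subgroup.m_inv_closed)
  qed
  have yc: "y \<in> carrier G" using y classc by blast
  let ?b = "g \<otimes> a \<otimes> inv g"
  have bc: "?b \<in> carrier G" using g a by simp
  have "g \<otimes> u \<otimes> inv g \<otimes> ?b = u \<otimes> y"
    using y(2) g uc a by (simp add: m_assoc mult_inv_cancel_left)
  then have "g \<otimes> u \<otimes> inv g = u \<otimes> y \<otimes> inv ?b"
    using bc g uc yc by (metis inv_solve_right inv_closed m_closed)
  then have "inv u \<otimes> (g \<otimes> u \<otimes> inv g) = y \<otimes> inv ?b"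
    using bc uc yc by (simp add: m_assoc mult_inv_cancel_left)
  moreover have "?b \<in> ?H" using inH[of ?b] g by (auto simp: conjugacy_class_def)
  ultimately show ?thesis using inH[OF y(1)] H
    by (simp add: subgroup.m_closed subgroup.m_inv_closed)
qed

text \<open>The three subgroups lemma: \<open>[W,G,W] = 1\<close> implies \<open>[W,W,G] = 1\<close>. Elementwise, conjugation by \<open>g\<close>
  changes \<open>v\<close> and \<open>w\<close> only by factors \<open>h\<close> and \<open>k\<close> which cancel from the commutator, since \<open>h\<close>
  commutes with the conjugate of \<open>w\<close>, and \<open>k\<close> commutes with \<open>v\<close>.\<close>

lemma commutator_in_centre:
  assumes W: "W \<subseteq> carrier G"
    and trivial: "\<And>w g. w \<in> W \<Longrightarrow> g \<in> carrier G \<Longrightarrow>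
      inv w \<otimes> (g \<otimes> w \<otimes> inv g) \<in> centralizer G W"
    and v: "v \<in> W" and w: "w \<in> W"
  shows "v \<otimes> w \<otimes> inv v \<otimes> inv w \<in> centre G"
proof -
  have vc: "v \<in> carrier G" and wc: "w \<in> carrier G" using v w W by auto
  let ?z = "v \<otimes> w \<otimes> inv v \<otimes> inv w"
  have "?z \<otimes> g = g \<otimes> ?z" if g: "g \<in> carrier G" for g
  proof -
    define v' where "v' = g \<otimes> v \<otimes> inv g"
    define w' where "w' = g \<otimes> w \<otimes> inv g"
    define h where "h = inv v \<otimes> v'"
    define k where "k = inv w \<otimes> w'"
    have c: "v' \<in> carrier G" "w' \<in> carrier G" "h \<in> carrier G" "k \<in> carrier G"
      using g vc wc by (simp_all add: v'_def w'_def h_def k_def)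
    have v': "v' = v \<otimes> h" and w': "w' = w \<otimes> k"
      using vc wc c by (simp_all add: h_def k_def mult_inv_cancel_left)
    have kv: "k \<otimes> v = v \<otimes> k"
      using trivial[OF w g] v by (auto simp: centralizer_def k_def w'_def)
    \<comment> \<open>Transported back by \<open>g\<inverse>\<close>, this says that \<open>g\<inverse> h g\<close> commutes with \<open>w\<close>, and \<open>g\<inverse> h g\<close> is the inverse
      of the commutator of \<open>v\<close> with \<open>g\<inverse>\<close>.\<close>
    have hw': "h \<otimes> w' = w' \<otimes> h"
    proof -
      have "inv g \<otimes> h \<otimes> g = inv (inv v \<otimes> (inv g \<otimes> v \<otimes> inv (inv g)))"
        using g vc by (simp add: h_def v'_def inv_mult_group m_assoc)
      moreover have "inv (inv v \<otimes> (inv g \<otimes> v \<otimes> inv (inv g))) \<in> centralizer G W"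
        using trivial[OF v, of "inv g"] g subgroup_centralizer[OF W]
        by (simp add: subgroup.m_inv_closed)
      ultimately have "inv g \<otimes> h \<otimes> g \<otimes> w = w \<otimes> (inv g \<otimes> h \<otimes> g)"
        using w by (auto simp: centralizer_def)
      then have "g \<otimes> (inv g \<otimes> h \<otimes> g \<otimes> w) \<otimes> inv g = g \<otimes> (w \<otimes> (inv g \<otimes> h \<otimes> g)) \<otimes> inv g"
        by simp
      then show ?thesis using g wc c by (simp add: w'_def m_assoc mult_inv_cancel_left)
    qed
    have "g \<otimes> ?z \<otimes> inv g = v' \<otimes> w' \<otimes> inv v' \<otimes> inv w'"
      using g vc wc by (simp add: v'_def w'_def m_assoc inv_mult_group mult_inv_cancel_left)
    also have "\<dots> = v \<otimes> (h \<otimes> w') \<otimes> inv h \<otimes> inv v \<otimes> inv w'"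
      using c vc by (simp add: v' m_assoc inv_mult_group)
    also have "\<dots> = v \<otimes> w' \<otimes> inv v \<otimes> inv w'"
      unfolding hw' using c vc by (simp add: m_assoc mult_inv_cancel_left)
    also have "\<dots> = v \<otimes> w \<otimes> (k \<otimes> inv v) \<otimes> inv k \<otimes> inv w"
      using c vc wc by (simp add: w' m_assoc inv_mult_group)
    also have "k \<otimes> inv v = inv v \<otimes> k"
      by (rule commute_inv[OF c(4) vc kv])
    also have "v \<otimes> w \<otimes> (inv v \<otimes> k) \<otimes> inv k \<otimes> inv w = ?z"
      using c vc wc by (simp add: m_assoc mult_inv_cancel_left)
    finally have "g \<otimes> ?z \<otimes> inv g = ?z" .
    then show ?thesis using g vc wc by (metis inv_closed inv_solve_right m_closed)
  qed
  then show ?thesis using vc wc by (simp add: centre_def)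
qed

section \<open>The index of the second centre\<close>

text \<open>The elements commuting with \<open>x\<close> modulo the centre form a subgroup: the preimage of a centraliser
  in \<open>G/Z(G)\<close>.\<close>

lemma commuting_mod_centre_generate:
  assumes x: "x \<in> carrier G" and A: "A \<subseteq> carrier G"
    and comm: "\<And>g. g \<in> A \<Longrightarrow> \<exists>z \<in> centre G. x \<otimes> g = z \<otimes> (g \<otimes> x)"
    and g: "g \<in> generate G A"
  shows "\<exists>z \<in> centre G. x \<otimes> g = z \<otimes> (g \<otimes> x)"
  using g
proof (induction rule: generate.induct)
  case one
  then show ?case using x subgroup.one_closed[OF subgroup_centre] by (intro bexI[of _ \<one>]) auto
next
  case (incl h)
  then show ?case by (rule comm)
next
  case (inv h)
  then have hc: "h \<in> carrier G" using A by blast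
  obtain z where z: "z \<in> centre G" "x \<otimes> h = z \<otimes> (h \<otimes> x)" using comm inv by blast
  have zc: "z \<in> carrier G" and central: "\<And>y. y \<in> carrier G \<Longrightarrow> z \<otimes> y = y \<otimes> z"
    using z by (auto simp: centre_def)
  have "inv h \<otimes> (x \<otimes> h) \<otimes> inv h = inv h \<otimes> (z \<otimes> (h \<otimes> x)) \<otimes> inv h" using z by simp
  then have "inv h \<otimes> x = inv h \<otimes> (z \<otimes> (h \<otimes> x)) \<otimes> inv h"
    using hc x by (simp add: m_assoc)
  also have "\<dots> = inv h \<otimes> (h \<otimes> x \<otimes> z) \<otimes> inv h"
    using central[of "h \<otimes> x"] hc x by simp
  also have "\<dots> = x \<otimes> (z \<otimes> inv h)"
    using hc zc x by (simp add: m_assoc mult_inv_cancel_left)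
  also have "\<dots> = x \<otimes> inv h \<otimes> z" using central[of "inv h"] hc zc x by (simp add: m_assoc)
  also have "\<dots> = z \<otimes> (x \<otimes> inv h)" using central[of "x \<otimes> inv h"] hc x by simp
  finally have "x \<otimes> inv h = inv z \<otimes> (inv h \<otimes> x)"
    using hc zc x by (simp add: mult_inv_cancel_left)
  then show ?case using subgroup.m_inv_closed[OF subgroup_centre z(1)] by blast
next
  case (eng g h)
  then obtain y z where y: "y \<in> centre G" "x \<otimes> g = y \<otimes> (g \<otimes> x)"
    and z: "z \<in> centre G" "x \<otimes> h = z \<otimes> (h \<otimes> x)" by blast
  have gc: "g \<in> carrier G" and hc: "h \<in> carrier G"
    using eng.hyps generate_in_carrier[OF A] by auto
  have yc: "y \<in> carrier G" and zc: "z \<in> carrier G"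
    and central: "\<And>u. u \<in> carrier G \<Longrightarrow> z \<otimes> u = u \<otimes> z"
    using y z by (auto simp: centre_def)
  have "x \<otimes> (g \<otimes> h) = y \<otimes> (g \<otimes> (x \<otimes> h))"
    using y x gc hc yc by (simp flip: m_assoc)
  also have "\<dots> = y \<otimes> ((g \<otimes> z) \<otimes> (h \<otimes> x))"
    using z x gc hc yc zc by (simp add: m_assoc)
  also have "\<dots> = y \<otimes> z \<otimes> (g \<otimes> h \<otimes> x)"
    using x gc hc yc zc by (simp add: m_assoc flip: central[OF gc])
  finally show ?case using subgroup.m_closed[OF subgroup_centre y(1) z(1)] by blast
qed

lemma upper_central_SucI:
  assumes x: "x \<in> carrier G"
    and comm: "\<And>g. g \<in> carrier G \<Longrightarrow> \<exists>z \<in> upper_central G i. x \<otimes> g = z \<otimes> (g \<otimes> x)"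
  shows "x \<in> upper_central G (Suc i)"
proof -
  let ?N = "upper_central G i"
  interpret N: normal ?N G by (rule upper_central_normal)
  interpret Q: group "G Mod ?N" by (rule N.factorgroup_is_group)
  interpret h: group_hom G "G Mod ?N" "\<lambda>x. ?N #> x"
    by unfold_locales (rule N.r_coset_hom_Mod)
  have "(?N #> x) \<otimes>\<^bsub>G Mod ?N\<^esub> Y = Y \<otimes>\<^bsub>G Mod ?N\<^esub> (?N #> x)"
    if Y: "Y \<in> carrier (G Mod ?N)" for Y
  proof -
    obtain g where g: "g \<in> carrier G" "Y = ?N #> g"
      using Y by (auto simp: FactGroup_def RCOSETS_def)
    obtain z where z: "z \<in> ?N" "x \<otimes> g = z \<otimes> (g \<otimes> x)" using comm[OF g(1)] by blast
    have zc: "z \<in> carrier G" using z(1) by (rule N.mem_carrier)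
    have z1: "?N #> z = \<one>\<^bsub>G Mod ?N\<^esub>"
      using N.rcos_const[OF is_group z(1)] by (simp add: FactGroup_def)
    have "(?N #> x) \<otimes>\<^bsub>G Mod ?N\<^esub> Y = ?N #> (x \<otimes> g)"
      using x g by (simp only: h.hom_mult)
    also have "\<dots> = (?N #> z) \<otimes>\<^bsub>G Mod ?N\<^esub> ((?N #> g) \<otimes>\<^bsub>G Mod ?N\<^esub> (?N #> x))"
      unfolding z(2) using x g zc by (simp only: h.hom_mult m_closed)
    also have "\<dots> = Y \<otimes>\<^bsub>G Mod ?N\<^esub> (?N #> x)"
      unfolding z1 using x g by (simp only: Q.l_one Q.m_closed h.hom_closed)
    finally show ?thesis .
  qed
  moreover have "?N #> x \<in> carrier (G Mod ?N)" using x by (rule h.hom_closed)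
  ultimately show ?thesis using x by (simp add: centre_def)
qed

lemma centre_subset_upper_central: "centre G \<subseteq> upper_central G (Suc 0)"
proof
  fix z assume "z \<in> centre G"
  then show "z \<in> upper_central G (Suc 0)"
    by (intro upper_central_SucI) (auto simp: centre_def)
qed

lemma upper_central_subset_hypercentre:
  assumes fin: "finite (carrier G)"
  shows "upper_central G j \<subseteq> hypercentre G"
proof -
  define i where "i = (LEAST i. upper_central G (Suc i) = upper_central G i)"
  have stable: "upper_central G (Suc i) = upper_central G i"
    unfolding i_def by (rule LeastI_ex[OF upper_central_stabilises[OF fin]])
  have const: "upper_central G (k + i) = upper_central G i" for k
  proof (induction k)
    case (Suc k)
    then have "upper_central G (Suc (k + i)) = upper_central G (Suc i)"
      by (simp only: upper_central.simps)
    then show ?case using stable by simp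
  qed simp
  have "upper_central G j \<subseteq> upper_central G (j + i)"
    by (rule lift_Suc_mono_le[of "upper_central G"]) (simp_all only: upper_central_mono le_add1)
  then show ?thesis unfolding const by (simp only: hypercentre_def i_def)
qed

text \<open>Here \<open>d\<close> is the number of elements that generate \<open>G\<close> together with \<open>W = C(S \<union> {a})\<close>; it is
  bounded by the logarithm of the index of \<open>W\<close>.\<close>

lemma card_le_power_times_second_centre:
  assumes fin: "finite (carrier G)"
    and bfc: "\<And>x. x \<in> carrier G \<Longrightarrow> card (conjugacy_class G x) \<le> n"
    and n: "n > 0" and t: "n\<^sup>2 \<le> 2 ^ t"
  shows "\<exists>d. 2 ^ d \<le> n ^ Suc t \<and>
    card (carrier G) \<le> n ^ (Suc t + d) * card (upper_central G 2)"
proof -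
  have finsub: "finite A" if "A \<subseteq> carrier G" for A using that fin finite_subset by blast
  have carr: "subgroup (carrier G) G" by (rule subgroup_self)
  let ?N = "Max ((\<lambda>x. card (conjugacy_class G x)) ` carrier G)"
  have "?N \<in> (\<lambda>x. card (conjugacy_class G x)) ` carrier G"
    using fin one_closed by (intro Max_in) auto
  then obtain a where a: "a \<in> carrier G" and "card (conjugacy_class G a) = ?N" by auto
  then have max: "card (conjugacy_class G x) \<le> card (conjugacy_class G a)"
    if "x \<in> carrier G" for x using that fin by simp
  let ?C = "centralizer G {a}"
  have C: "subgroup ?C G" using a by (simp add: subgroup_centralizer)
  have "card (carrier G) \<le> card (conjugacy_class G a) * card (carrier G \<inter> ?C)"
    by (rule card_le_conjugacy_class_times_centralizer[OF fin carr a])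
  also have "carrier G \<inter> ?C = ?C" using subgroup.subset[OF C] by blast
  also have "card (conjugacy_class G a) * card ?C \<le> n * card ?C"
    using bfc[OF a] by simp
  finally have index: "card (carrier G) \<le> n * card ?C" .
  obtain S where S: "S \<subseteq> carrier G" "card S \<le> t"
    and trans: "\<And>g. g \<in> carrier G \<Longrightarrow> \<exists>h \<in> generate G S. \<exists>c \<in> ?C. g = h \<otimes> c"
    using few_elements_transitive_on_cosets[OF fin C index t] by blast
  define W where "W = centralizer G (insert a S)"
  have aS: "insert a S \<subseteq> carrier G" using a S by blast
  have W: "subgroup W G" unfolding W_def by (rule subgroup_centralizer[OF aS])
  have Wc: "W \<subseteq> carrier G" using W by (rule subgroup.subset)
  have "card (carrier G) \<le> n ^ card (insert a S) * card (carrier G \<inter> W)"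
    unfolding W_def
    by (rule card_le_power_times_centralizer[OF fin bfc carr finsub[OF aS] aS])
  also have "carrier G \<inter> W = W" using Wc by blast
  also have "n ^ card (insert a S) * card W \<le> n ^ Suc t * card W"
    using n S finsub[OF S(1)] by (intro mult_right_mono power_increasing) (auto simp: card_insert_if)
  finally have indexW: "card (carrier G) \<le> n ^ Suc t * card W" .
  have centre_comm: "v \<otimes> w \<otimes> inv v \<otimes> inv w \<in> centre G" if "v \<in> W" "w \<in> W" for v w
  proof (rule commutator_in_centre[OF Wc _ that])
    fix w g assume w: "w \<in> W" and g: "g \<in> carrier G"
    have "w \<in> centralizer G S" using w by (auto simp: W_def centralizer_def)
    then have "inv w \<otimes> (g \<otimes> w \<otimes> inv g) \<in> generate G (insert a S)"
      using commutator_in_generate[OF fin a max S(1) trans] g by blast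
    moreover have "W = centralizer G (generate G (insert a S))"
      unfolding W_def by (rule centralizer_generate[OF aS, symmetric])
    ultimately show "inv w \<otimes> (g \<otimes> w \<otimes> inv g) \<in> centralizer G W"
      using g w Wc by (auto simp: centralizer_def)
  qed
  obtain T where T: "T \<subseteq> carrier G" and gen: "generate G (W \<union> T) = carrier G"
    and cardT: "2 ^ card T * card W \<le> card (carrier G)"
    using generating_complement_of_subgroup[OF fin W] by blast
  have "2 ^ card T * card W \<le> n ^ Suc t * card W" using cardT indexW by (rule le_trans)
  moreover have "card W > 0" using finsub[OF Wc] subgroup.one_closed[OF W] card_gt_0_iff by blast
  ultimately have d: "2 ^ card T \<le> n ^ Suc t" by simp
  have "W \<inter> centralizer G T \<subseteq> upper_central G (Suc (Suc 0))"
  proof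
    fix x assume x: "x \<in> W \<inter> centralizer G T"
    then have xc: "x \<in> carrier G" using Wc by blast
    show "x \<in> upper_central G (Suc (Suc 0))"
    proof (rule upper_central_SucI[OF xc])
      fix g assume "g \<in> carrier G"
      then have "g \<in> generate G (W \<union> T)" using gen by simp
      then have "\<exists>z \<in> centre G. x \<otimes> g = z \<otimes> (g \<otimes> x)"
      proof (rule commuting_mod_centre_generate[OF xc, rotated 2])
        show "W \<union> T \<subseteq> carrier G" using Wc T by blast
        fix y assume y: "y \<in> W \<union> T"
        show "\<exists>z \<in> centre G. x \<otimes> y = z \<otimes> (y \<otimes> x)"
        proof (cases "y \<in> W")
          case True
          then have yc: "y \<in> carrier G" using Wc by blast
          have "x \<otimes> y = x \<otimes> y \<otimes> inv x \<otimes> inv y \<otimes> (y \<otimes> x)"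
            using xc yc by (simp add: m_assoc mult_inv_cancel_left)
          then show ?thesis using centre_comm[of x y] x True by blast
        next
          case False
          then have "y \<in> T" using y by blast
          then have "x \<otimes> y = \<one> \<otimes> (y \<otimes> x)" using x T xc by (auto simp: centralizer_def)
          then show ?thesis using subgroup.one_closed[OF subgroup_centre] by blast
        qed
      qed
      then show "\<exists>z \<in> upper_central G (Suc 0). x \<otimes> g = z \<otimes> (g \<otimes> x)"
        using centre_subset_upper_central by blast
    qed
  qed
  then have "card (W \<inter> centralizer G T) \<le> card (upper_central G 2)"
    unfolding numeral_2_eq_2
    by (rule card_mono[OF finsub[OF upper_central_subset]])
  moreover have "card W \<le> n ^ card T * card (W \<inter> centralizer G T)"
    by (rule card_le_power_times_centralizer[OF fin bfc W finsub[OF T] T])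
  ultimately have "card W \<le> n ^ card T * card (upper_central G 2)"
    by (meson le_trans mult_le_mono2)
  then have "n ^ Suc t * card W \<le> n ^ Suc t * (n ^ card T * card (upper_central G 2))"
    by (rule mult_le_mono2)
  with indexW have "card (carrier G) \<le> n ^ (Suc t + card T) * card (upper_central G 2)"
    by (simp only: power_add mult.assoc)
  with d show ?thesis by blast
qed

end

section \<open>The index of the hypercentre\<close>

theorem corollary4:
  fixes G :: "('a, 'b) monoid_scheme" and n :: nat
  assumes "n \<ge> 2"
    and "BFC_group n G"
    and "finite (carrier G)"
  shows "real (card (rcosets\<^bsub>G\<^esub> (hypercentre G)))
    < real n powr (64 * (log 2 (real n)) ^ 5)"
proof -
  interpret group G using assms(2) by (simp add: BFC_group_def)
  note fin = assms(3)
  define k where "k = log 2 (real n)"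
  have n_eq: "2 powr k = real n" using assms(1) by (simp add: k_def)
  have k: "k \<ge> 1" using assms(1) by (simp add: k_def)
  define t where "t = nat \<lceil>2 * k\<rceil>"
  have t_ge: "2 * k \<le> real t" unfolding t_def by (rule real_nat_ceiling_ge)
  have t_le: "real t \<le> 2 * k + 1" unfolding t_def using k by linarith
  have "real (n\<^sup>2) = 2 powr (2 * k)"
    by (simp add: power2_eq_square flip: n_eq powr_add)
  also have "\<dots> \<le> 2 powr real t" using t_ge by simp
  also have "\<dots> = real (2 ^ t)" by (simp add: powr_realpow)
  finally have t: "n\<^sup>2 \<le> 2 ^ t" by (simp only: of_nat_le_iff)
  have bfc: "card (conjugacy_class G x) \<le> n" if "x \<in> carrier G" for x
    using assms(2) that by (simp add: BFC_group_def)
  obtain d where d: "2 ^ d \<le> n ^ Suc t"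
    and le: "card (carrier G) \<le> n ^ (Suc t + d) * card (upper_central G 2)"
    using card_le_power_times_second_centre[OF fin bfc _ t] assms(1) by auto
  have hyper: "subgroup (hypercentre G) G"
    unfolding hypercentre_def by (rule normal_imp_subgroup[OF upper_central_normal])
  have finhyper: "finite (hypercentre G)"
    using subgroup.subset[OF hyper] fin finite_subset by blast
  have "card (rcosets\<^bsub>G\<^esub> (hypercentre G)) * card (hypercentre G) = card (carrier G)"
    using lagrange[OF hyper] by (simp add: order_def)
  also have "\<dots> \<le> n ^ (Suc t + d) * card (hypercentre G)"
    using le card_mono[OF finhyper upper_central_subset_hypercentre[OF fin]]
    by (meson le_trans mult_le_mono2)
  finally have "card (rcosets\<^bsub>G\<^esub> (hypercentre G)) \<le> n ^ (Suc t + d)"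
    using finhyper subgroup.one_closed[OF hyper] card_gt_0_iff by (metis empty_iff mult_le_cancel2)
  then have "real (card (rcosets\<^bsub>G\<^esub> (hypercentre G))) \<le> real n ^ (Suc t + d)"
    by (metis of_nat_le_iff of_nat_power)
  also have "\<dots> = real n powr (real (Suc t + d))"
    using assms(1) by (simp only: powr_realpow)
  also have "\<dots> < real n powr (64 * k ^ 5)"
  proof -
    have "2 powr real d = real (2 ^ d)" by (simp add: powr_realpow)
    also have "\<dots> \<le> real (n ^ Suc t)" using d by (rule of_nat_mono)
    also have "\<dots> = (2 powr k) powr real (Suc t)"
      unfolding n_eq using assms(1) by (simp only: powr_realpow of_nat_power)
    also have "\<dots> = 2 powr (k * real (Suc t))" by (rule powr_powr)
    finally have "real d \<le> k * real (Suc t)" by simp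
    then have "real (Suc t + d) \<le> real (Suc t) * (1 + k)" by (simp add: algebra_simps)
    also have "\<dots> \<le> (4 * k) * (2 * k)"
      using t_le k by (intro mult_mono) auto
    also have "\<dots> = 8 * k ^ 2" by (simp add: power2_eq_square)
    also have "\<dots> < 64 * k ^ 2" using k by simp
    also have "\<dots> \<le> 64 * k ^ 5" using k by (intro mult_left_mono power_increasing) auto
    finally show ?thesis using assms(1) by simp
  qed
  finally show ?thesis by (simp only: k_def)
qed

end
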